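(* Let $k$ be a field of characteristic zero, let $k[X]=k[x_0,x_1,\ldots,x_n]$, and let $D$ be an arbitrary $k$-linear derivation of $k[X]$. Suppose $U$ and $U^*$ are two dual $D$-modules in $k[X]$. Then the Casimir element $\Delta(U,U^* )$ belongs to the kernel $k[X]^{D}=\{f\in k[X] : D(f)=0\}$.
   Context: A finite-dimensional subspace $V\subseteq k[X]$ is a $D$-module (in $k[X]$) if $D(V)\subseteq V$. Two $D$-modules $V,V^*$ in $k[X]$ are dual if they have bases $\{v_i\}$ of $V$ and $\{v_i^*\}$ of $V^*$ (called dual bases), indexed by the same finite set, such that whenever $D(v_i)=\sum_j\lambda_{ij}v_j$ one has $D(v_i^* )=-\sum_j\lambda_{ji}v_j^*$; i.e. the matrix of $D$ on $V^*$ is minus the transpose of the matrix of $D$ on $V$. The Casimir element of $D$ attached to such dual modules (with such dual bases) is the polynomial $\Delta(V,V^* )=\sum_i v_i\cdot v_i^*\in k[X]$. *)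

theory Defs
  imports Complex_Main "HOL-Library.Poly_Mapping"
begin

text \<open>Multivariate polynomials over \<^typ>\<open>'k\<close> as finitely supported maps from exponent vectors
  to coefficients; the product of \<^theory>\<open>HOL-Library.Poly_Mapping\<close> is the convolution product.
  The finite type \<^typ>\<open>'x\<close> indexes the variables, so \<open>k[x\<^sub>0, \<dots>, x\<^sub>n]\<close> is the case
  \<open>CARD('x) = n + 1\<close>.\<close>

type_synonym ('x, 'k) mpoly = "('x \<Rightarrow>\<^sub>0 nat) \<Rightarrow>\<^sub>0 'k"

definition mpoly_scale :: "'k::field \<Rightarrow> ('x, 'k) mpoly \<Rightarrow> ('x, 'k) mpoly"
  where "mpoly_scale c f = Poly_Mapping.single 0 c * f"

global_interpretation mpoly: vector_space "mpoly_scale :: 'k::field \<Rightarrow> ('x, 'k) mpoly \<Rightarrow> _"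
  by unfold_locales
    (simp_all add: mpoly_scale_def algebra_simps single_add mult_single flip: mult.assoc)

definition derivation :: "(('x, 'k::field) mpoly \<Rightarrow> ('x, 'k) mpoly) \<Rightarrow> bool"
  where "derivation D \<longleftrightarrow>
    Vector_Spaces.linear mpoly_scale mpoly_scale D \<and> (\<forall>f g. D (f * g) = D f * g + f * D g)"

definition D_module ::
    "(('x, 'k::field) mpoly \<Rightarrow> ('x, 'k) mpoly) \<Rightarrow> ('x, 'k) mpoly set \<Rightarrow> bool"
  where "D_module D V \<longleftrightarrow>
    mpoly.subspace V \<and> (\<exists>B. finite B \<and> mpoly.span B = V) \<and> D ` V \<subseteq> V"

definition basis_family :: "'i set \<Rightarrow> ('i \<Rightarrow> ('x, 'k::field) mpoly) \<Rightarrow> ('x, 'k) mpoly set \<Rightarrow> bool"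
  where "basis_family I v V \<longleftrightarrow>
    inj_on v I \<and> mpoly.independent (v ` I) \<and> mpoly.span (v ` I) = V"

text \<open>Two \<open>D\<close>-modules are dual iff they possess dual bases. The matrix \<open>l\<close> below exists and is
  unique on \<open>I \<times> I\<close>, because \<open>v\<close> is a basis of the \<open>D\<close>-stable space \<open>V\<close>.\<close>

definition dual_bases ::
    "(('x, 'k::field) mpoly \<Rightarrow> ('x, 'k) mpoly) \<Rightarrow> ('x, 'k) mpoly set \<Rightarrow> ('x, 'k) mpoly set \<Rightarrow>
      'i set \<Rightarrow> ('i \<Rightarrow> ('x, 'k) mpoly) \<Rightarrow> ('i \<Rightarrow> ('x, 'k) mpoly) \<Rightarrow> bool"
  where "dual_bases D V V' I v v' \<longleftrightarrow>
    finite I \<and> basis_family I v V \<and> basis_family I v' V' \<and>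
    (\<forall>l :: 'i \<Rightarrow> 'i \<Rightarrow> 'k.
      (\<forall>i\<in>I. D (v i) = (\<Sum>j\<in>I. mpoly_scale (l i j) (v j))) \<longrightarrow>
      (\<forall>i\<in>I. D (v' i) = - (\<Sum>j\<in>I. mpoly_scale (l j i) (v' j))))"

definition casimir ::
    "'i set \<Rightarrow> ('i \<Rightarrow> ('x, 'k::field) mpoly) \<Rightarrow> ('i \<Rightarrow> ('x, 'k) mpoly) \<Rightarrow> ('x, 'k) mpoly"
  where "casimir I v v' = (\<Sum>i\<in>I. v i * v' i)"

definition D_kernel :: "(('x, 'k::field) mpoly \<Rightarrow> ('x, 'k) mpoly) \<Rightarrow> ('x, 'k) mpoly set"
  where "D_kernel D = {f. D f = 0}"

end

theory Submission
  imports Defs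
begin

text \<open>Stability of \<open>U\<close> under \<open>D\<close> provides a matrix \<open>l\<close> with
  \<open>D u\<^sub>i = \<Sum>\<^sub>j l\<^sub>i\<^sub>j u\<^sub>j\<close> (lemma \<open>family_matrix_exists\<close>), and duality then says
  \<open>D u'\<^sub>i = - \<Sum>\<^sub>j l\<^sub>j\<^sub>i u'\<^sub>j\<close>. By the Leibniz rule
  \<open>D (\<Sum>\<^sub>i u\<^sub>i u'\<^sub>i) = \<Sum>\<^sub>i\<^sub>j l\<^sub>i\<^sub>j u\<^sub>j u'\<^sub>i - \<Sum>\<^sub>i\<^sub>j l\<^sub>j\<^sub>i u\<^sub>i u'\<^sub>j\<close>,
  and the two double sums agree after exchanging the names of \<open>i\<close> and \<open>j\<close>. Conceptually, the
  Casimir element is the image under multiplication of the canonical invariant of \<open>U \<otimes> U\<^sup>*\<close>,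
  and multiplication commutes with \<open>D\<close> because \<open>D\<close> is a derivation.\<close>

lemma mpoly_scale_mult_left: "mpoly_scale c f * g = mpoly_scale c (f * g)"
  by (simp add: mpoly_scale_def mult.assoc)

lemma mpoly_scale_mult_right: "f * mpoly_scale c g = mpoly_scale c (f * g)"
  by (simp add: mpoly_scale_def mult.left_commute)

lemma in_span_family_expansion:
  assumes "finite I" and "inj_on v I" and "w \<in> mpoly.span (v ` I)"
  shows "\<exists>c. w = (\<Sum>j\<in>I. mpoly_scale (c j) (v j))"
proof -
  obtain d where "w = (\<Sum>x\<in>v ` I. mpoly_scale (d x) x)"
    using assms by (auto simp: mpoly.span_finite)
  then have "w = (\<Sum>j\<in>I. mpoly_scale (d (v j)) (v j))"
    using assms(2) by (simp add: sum.reindex)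
  then show ?thesis
    by (rule exI[where x = "\<lambda>j. d (v j)"])
qed

text \<open>The definition of dual bases constrains the images \<open>D v'\<^sub>i\<close> only through the matrices that
  represent \<open>D\<close> on the first basis; this lemma keeps that condition from being vacuous.\<close>

lemma family_matrix_exists:
  assumes "finite I" and "basis_family I v V" and "D ` V \<subseteq> V"
  shows "\<exists>l. \<forall>i\<in>I. D (v i) = (\<Sum>j\<in>I. mpoly_scale (l i j) (v j))"
proof -
  from assms(2) have inj: "inj_on v I" and span: "mpoly.span (v ` I) = V"
    by (simp_all add: basis_family_def)
  have "D (v i) \<in> mpoly.span (v ` I)" if "i \<in> I" for i
    using assms(3) span mpoly.span_base[of "v i" "v ` I"] that by blast
  then have "\<forall>i\<in>I. \<exists>c. D (v i) = (\<Sum>j\<in>I. mpoly_scale (c j) (v j))"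
    using in_span_family_expansion[OF assms(1) inj] by blast
  then show ?thesis
    by (rule bchoice)
qed

lemma derivation_sum:
  assumes "derivation D"
  shows "D (\<Sum>i\<in>I. f i) = (\<Sum>i\<in>I. D (f i))"
proof -
  interpret D: Vector_Spaces.linear mpoly_scale mpoly_scale D
    using assms by (simp add: derivation_def)
  show ?thesis
    by (rule D.sum)
qed

theorem theorem2p2:
  fixes D :: "('x::finite, 'k::field_char_0) mpoly \<Rightarrow> ('x, 'k) mpoly"
    and U U' :: "('x, 'k) mpoly set"
    and I :: "'i set"
    and u u' :: "'i \<Rightarrow> ('x, 'k) mpoly"
  assumes "derivation D"
    and "D_module D U" and "D_module D U'"
    and "dual_bases D U U' I u u'"
  shows "casimir I u u' \<in> D_kernel D"
proof -
  have fin: "finite I" and basis: "basis_family I u U"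
    using assms(4) by (simp_all add: dual_bases_def)
  have "D ` U \<subseteq> U"
    using assms(2) by (simp add: D_module_def)
  then obtain l where l: "\<forall>i\<in>I. D (u i) = (\<Sum>j\<in>I. mpoly_scale (l i j) (u j))"
    using family_matrix_exists[OF fin basis] by blast
  then have l': "\<forall>i\<in>I. D (u' i) = - (\<Sum>j\<in>I. mpoly_scale (l j i) (u' j))"
    using assms(4) unfolding dual_bases_def by blast
  have leibniz: "D (f * g) = D f * g + f * D g" for f g
    using assms(1) by (simp add: derivation_def)
  have "D (casimir I u u') = (\<Sum>i\<in>I. D (u i) * u' i) + (\<Sum>i\<in>I. u i * D (u' i))"
    by (simp add: casimir_def derivation_sum[OF assms(1)] leibniz sum.distrib)
  also have "(\<Sum>i\<in>I. D (u i) * u' i) = (\<Sum>i\<in>I. \<Sum>j\<in>I. mpoly_scale (l i j) (u j * u' i))"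
    using l by (simp add: sum_distrib_right mpoly_scale_mult_left)
  also have "\<dots> = (\<Sum>i\<in>I. \<Sum>j\<in>I. mpoly_scale (l j i) (u i * u' j))"
    by (rule sum.swap)
  also have "(\<Sum>i\<in>I. u i * D (u' i)) = - (\<Sum>i\<in>I. \<Sum>j\<in>I. mpoly_scale (l j i) (u i * u' j))"
    using l' by (simp add: sum_distrib_left mpoly_scale_mult_right sum_negf)
  finally show ?thesis
    by (simp add: D_kernel_def)
qed

end
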